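(* Let $n\ge1$, $\gamma\in[0,1]^n$, and let $\mu$ be a Borel probability measure on $[0,1]^n$ such that there exist constants $c>0$, $C_1,C_2,M>0$ with \[ \sum_{q=Q}^{2Q}\mu(A(\delta,q,\gamma))\le C_2Q\delta^n \] for all integers $Q\ge M$ and all $\delta$ with $C_1Q^{-1/n-c}\le\delta<1$. Then for every non-increasing $\psi:\mathbb{N}\to(0,1]$ with $\sum_{q\ge1}\psi(q)^n<\infty$, we have $\mu(W(\psi,\gamma))=0$.
   Context: $\|x\|$ is the distance from $x\in\mathbb{R}^n$ to $\mathbb{Z}^n$; $A(\delta,Q,\gamma)=\{x\in\mathbb{R}^n:\|Qx-\gamma\|\le\delta\}$; $W(\psi,\gamma)=\{x\in\mathbb{R}^n:\|qx-\gamma\|\le\psi(q)\text{ for infinitely many }q\in\mathbb{N}\}$. *)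

theory Defs
  imports "HOL-Analysis.Analysis" "HOL-Probability.Probability_Measure"
begin

definition int_lattice :: "(real ^ 'n) set" where
  "int_lattice = {z. \<forall>i. z $ i \<in> \<int>}"

text \<open>The distance is taken with respect to the Euclidean metric of \<open>real ^ 'n\<close>.\<close>

definition dist_int :: "real ^ 'n \<Rightarrow> real" where
  "dist_int x = infdist x int_lattice"

definition rational_nbhd :: "real \<Rightarrow> nat \<Rightarrow> real ^ 'n \<Rightarrow> (real ^ 'n) set" where
  "rational_nbhd \<delta> Q \<gamma> = {x. dist_int (real Q *\<^sub>R x - \<gamma>) \<le> \<delta>}"

definition well_approximable :: "(nat \<Rightarrow> real) \<Rightarrow> real ^ 'n \<Rightarrow> (real ^ 'n) set" where
  "well_approximable \<psi> \<gamma> =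
    {x. infinite {q. q \<ge> 1 \<and> dist_int (real q *\<^sub>R x - \<gamma>) \<le> \<psi> q}}"

text \<open>A Borel probability measure on the unit cube is encoded as a Borel probability measure on
  the whole space that gives the cube full mass; \<open>1\<close> below is the vector all of whose
  components equal \<open>1\<close>.\<close>

definition borel_prob_on_cube :: "(real ^ 'n) measure \<Rightarrow> bool" where
  "borel_prob_on_cube \<mu> \<longleftrightarrow>
    prob_space \<mu> \<and> sets \<mu> = sets borel \<and> emeasure \<mu> (cbox 0 1) = 1"

end

theory Submission
  imports Defs
begin

text \<open>Replace \<open>\<psi>\<close> on the dyadic block \<open>2^k \<le> q \<le> 2^(k+1)\<close> by the constant
  \<open>\<delta> k = max (\<psi> (2^k)) (C1 * (2^k) powr (-1/n - c))\<close>: by monotonicity this only enlarges the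
  neighbourhoods, and it brings \<open>\<delta> k\<close> into the range of the counting hypothesis. The block then
  contributes at most \<open>C2 * 2^k * \<delta> k ^ n\<close>, which is summable by Cauchy condensation and a geometric
  series of ratio \<open>2 powr (- c * n)\<close>, so the Borel--Cantelli lemma applies.\<close>

lemma closed_rational_nbhd: "closed (rational_nbhd \<delta> q \<gamma>)"
  unfolding rational_nbhd_def dist_int_def
  by (intro closed_Collect_le continuous_intros)

lemma rational_nbhd_mono: "\<delta> \<le> \<epsilon> \<Longrightarrow> rational_nbhd \<delta> q \<gamma> \<subseteq> rational_nbhd \<epsilon> q \<gamma>"
  by (auto simp: rational_nbhd_def)

lemma well_approximable_iff:
  "x \<in> well_approximable \<psi> \<gamma> \<longleftrightarrow> (\<forall>m. \<exists>q\<ge>m. q \<ge> 1 \<and> x \<in> rational_nbhd (\<psi> q) q \<gamma>)"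
  by (simp add: well_approximable_def rational_nbhd_def infinite_nat_iff_unbounded_le)

text \<open>A limsup set of closed sets is Borel. Membership in \<open>null_sets\<close> includes
  measurability, so this is what turns the almost-everywhere statement into a null set.\<close>

lemma well_approximable_borel: "well_approximable \<psi> \<gamma> \<in> sets borel"
proof -
  have "well_approximable \<psi> \<gamma> = (\<Inter>m. \<Union>q\<in>{q. m \<le> q \<and> 1 \<le> q}. rational_nbhd (\<psi> q) q \<gamma>)"
    by (auto simp: well_approximable_iff)
  also have "\<dots> \<in> sets borel"
    by (intro sets.countable_INT'' sets.countable_UN') (auto intro: borel_closed closed_rational_nbhd)
  finally show ?thesis .
qed

lemma summable_condensed_powers:
  fixes \<psi> :: "nat \<Rightarrow> real"
  assumes pos: "\<And>q. q \<ge> 1 \<Longrightarrow> 0 \<le> \<psi> q" and anti: "antimono_on {1..} \<psi>"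
    and sum: "summable (\<lambda>q. \<psi> (Suc q) ^ N)"
  shows "summable (\<lambda>k. 2 ^ k * \<psi> (2 ^ k) ^ N)"
proof -
  \<comment> \<open>The value at 0 is reset because nothing is assumed about
    \<open>\<psi> 0\<close>, while the condensation test wants nonnegativity at every index and
    decrease only from 1 on.\<close>
  define f where "f q = (if q = 0 then 0 else \<psi> q ^ N)" for q
  have "f (Suc m) \<le> f m" if "0 < m" for m
    using that pos[of "Suc m"] monotone_onD[OF anti, of m "Suc m"] by (auto simp: f_def intro: power_mono)
  moreover have "0 \<le> f m" for m
    using pos[of m] by (auto simp: f_def)
  moreover have "summable f"
    using sum summable_Suc_iff[of f] by (simp add: f_def)
  ultimately have "summable (\<lambda>k. 2 ^ k * f (2 ^ k))"
    using condensation_test[of f] by blast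
  then show ?thesis by (simp add: f_def)
qed

text \<open>The \<open>N\<close>-th power turns \<open>- 1 / real N\<close> into a factor
  \<open>2 powr (- real k)\<close> that cancels \<open>2 ^ k\<close> exactly; the decay comes only
  from \<open>c\<close>.\<close>

lemma summable_dyadic_powr:
  fixes c C :: real
  assumes "c > 0" "N > 0"
  shows "summable (\<lambda>k. 2 ^ k * (C * real (2 ^ k) powr (- 1 / real N - c)) ^ N)"
proof -
  have "2 ^ k * (C * real (2 ^ k) powr (- 1 / real N - c)) ^ N
      = C ^ N * (2 powr (- c * real N)) ^ k" for k
  proof -
    have "real (2 ^ k) = 2 powr real k"
      by (simp add: powr_realpow)
    then have "(real (2 ^ k) powr (- 1 / real N - c)) ^ N
        = 2 powr (real k * (- 1 / real N - c) * real N)"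
      using assms by (simp only: powr_powr powr_power)
        (simp add: powr_powr powr_power ac_simps)
    also have "real k * (- 1 / real N - c) * real N = real k * (- 1 - c * real N)"
      using assms by (simp add: field_simps)
    finally have "(real (2 ^ k) powr (- 1 / real N - c)) ^ N = 2 powr (real k * (- 1 - c * real N))" .
    then have "2 ^ k * (real (2 ^ k) powr (- 1 / real N - c)) ^ N
        = 2 powr (real k + real k * (- 1 - c * real N))"
      by (simp add: powr_add powr_realpow)
    also have "\<dots> = (2 powr (- c * real N)) ^ k"
      by (simp add: powr_power algebra_simps)
    finally show ?thesis by (simp add: power_mult_distrib)
  qed
  moreover have "(2::real) powr (- c * real N) < 1"
    using assms powr_less_mono[of "- c * real N" 0 "2::real"] by simp
  ultimately show ?thesis by (simp add: summable_mult)
qed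

text \<open>Borel-Cantelli is applied to one union per dyadic block. Comparing \<open>\<psi>\<close>
  with \<open>\<delta>\<close> at the left endpoint suffices, since \<open>\<psi>\<close> is largest
  there on the block.\<close>

lemma well_approximable_null:
  fixes \<gamma> :: "real ^ 'n" and \<psi> \<delta> :: "nat \<Rightarrow> real"
  assumes "finite_measure \<mu>" and sets: "sets \<mu> = sets borel"
    and anti: "antimono_on {1..} \<psi>"
    and \<delta>: "\<And>k. \<psi> (2 ^ k) \<le> \<delta> k"
    and sum: "summable (\<lambda>k. \<Sum>q=2^k..2*2^k. measure \<mu> (rational_nbhd (\<delta> k) q \<gamma>))"
  shows "well_approximable \<psi> \<gamma> \<in> null_sets \<mu>"
proof -
  interpret finite_measure \<mu> by fact
  \<comment> \<open>Both endpoints are included to match the range of the counting sum; consecutive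
    blocks share a power of 2, which is harmless for a union bound.\<close>
  define E where "E k = (\<Union>q\<in>{2^k..2*2^k}. rational_nbhd (\<delta> k) q \<gamma>)" for k
  have nb: "rational_nbhd d q \<gamma> \<in> sets \<mu>" for d q
    by (simp add: sets borel_closed closed_rational_nbhd)
  have E: "E k \<in> sets \<mu>" for k
    unfolding E_def by (intro sets.finite_UN nb) auto
  have "measure \<mu> (E k) \<le> (\<Sum>q=2^k..2*2^k. measure \<mu> (rational_nbhd (\<delta> k) q \<gamma>))" for k
    unfolding E_def by (intro finite_measure_subadditive_finite) (auto simp: nb)
  then have "summable (\<lambda>k. measure \<mu> (E k))"
    by (intro summable_comparison_test'[OF sum]) simp
  then have "AE x in \<mu>. eventually (\<lambda>k. x \<in> space \<mu> - E k) sequentially"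
    by (intro borel_cantelli_AE1 E) (simp_all add: less_top[symmetric])
  then have "AE x in \<mu>. x \<notin> well_approximable \<psi> \<gamma>"
  proof eventually_elim
    case (elim x)
    then obtain m where m: "\<And>k. k \<ge> m \<Longrightarrow> x \<notin> E k"
      by (auto simp: eventually_sequentially)
    show ?case
    proof
      assume "x \<in> well_approximable \<psi> \<gamma>"
      \<comment> \<open>Starting from \<open>2 ^ m\<close> forces the block containing
        \<open>q\<close> to have index at least \<open>m\<close>, where \<open>x\<close> avoids
        every \<open>E k\<close>.\<close>
      then obtain q where q: "q \<ge> 2 ^ m" "q \<ge> 1" "x \<in> rational_nbhd (\<psi> q) q \<gamma>"
        unfolding well_approximable_iff by blast
      obtain k where k: "2 ^ k \<le> q" "q < 2 ^ (k + 1)"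
        using ex_power_ivl1[of 2 q] q(2) by auto
      have "(2::nat) ^ m < 2 ^ (k + 1)" using q(1) k(2) by linarith
      then have "m < k + 1" by (subst (asm) power_strict_increasing_iff) auto
      then have "m \<le> k" by simp
      have "\<psi> q \<le> \<delta> k"
        using monotone_onD[OF anti, of "2 ^ k" q] k(1) q(2) \<delta>[of k] by simp
      then have "x \<in> rational_nbhd (\<delta> k) q \<gamma>"
        using q(3) rational_nbhd_mono by blast
      then have "x \<in> E k" using k by (auto simp: E_def)
      then show False using m \<open>m \<le> k\<close> by blast
    qed
  qed
  then show ?thesis
    using AE_iff_null_sets[of "well_approximable \<psi> \<gamma>" \<mu>] well_approximable_borel[of \<psi> \<gamma>] sets by blast
qed

theorem theorem9p1:
  fixes \<gamma> :: "real ^ 'n" and \<mu> :: "(real ^ 'n) measure"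
  assumes "\<gamma> \<in> cbox 0 1"
    and "borel_prob_on_cube \<mu>"
    and "\<exists>c>0. \<exists>C1>0. \<exists>C2>0. \<exists>M>0. \<forall>(Q::nat) (\<delta>::real).
           real Q \<ge> M \<longrightarrow> C1 * real Q powr (- 1 / real CARD('n) - c) \<le> \<delta> \<longrightarrow> \<delta> < 1 \<longrightarrow>
           (\<Sum>q=Q..2*Q. measure \<mu> (rational_nbhd \<delta> q \<gamma>)) \<le> C2 * real Q * \<delta> ^ CARD('n)"
  shows "\<forall>\<psi> :: nat \<Rightarrow> real.
           (\<forall>q\<ge>1. 0 < \<psi> q \<and> \<psi> q \<le> 1) \<longrightarrow>
           antimono_on {1..} \<psi> \<longrightarrow>
           summable (\<lambda>q. \<psi> (Suc q) ^ CARD('n)) \<longrightarrow>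
           well_approximable \<psi> \<gamma> \<in> null_sets \<mu>"
proof (intro allI impI)
  fix \<psi> :: "nat \<Rightarrow> real"
  assume \<psi>: "\<forall>q\<ge>1. 0 < \<psi> q \<and> \<psi> q \<le> 1" and anti: "antimono_on {1..} \<psi>"
    and sum: "summable (\<lambda>q. \<psi> (Suc q) ^ CARD('n))"
  let ?N = "CARD('n)"
  obtain c C1 C2 M where c: "c > 0" "C1 > 0" "C2 > 0"
    and bound: "\<And>(Q::nat) \<delta>. real Q \<ge> M \<Longrightarrow> C1 * real Q powr (- 1 / real ?N - c) \<le> \<delta> \<Longrightarrow> \<delta> < 1 \<Longrightarrow>
           (\<Sum>q=Q..2*Q. measure \<mu> (rational_nbhd \<delta> q \<gamma>)) \<le> C2 * real Q * \<delta> ^ ?N"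
    using assms(3) by blast
  define \<eta> where "\<eta> k = C1 * real (2 ^ k) powr (- 1 / real ?N - c)" for k :: nat
  define \<delta> where "\<delta> k = max (\<psi> (2 ^ k)) (\<eta> k)" for k
  have pos: "0 \<le> \<psi> (2 ^ k)" "0 \<le> \<eta> k" for k
    using \<psi> c by (auto simp: \<eta>_def less_imp_le)
  have sum\<delta>: "summable (\<lambda>k. 2 ^ k * \<delta> k ^ ?N)"
  proof (rule summable_comparison_test')
    show "summable (\<lambda>k. 2 ^ k * \<psi> (2 ^ k) ^ ?N + 2 ^ k * \<eta> k ^ ?N)"
      unfolding \<eta>_def using \<psi> c
      by (intro summable_add summable_condensed_powers anti sum summable_dyadic_powr)
        (auto simp: less_imp_le)
    \<comment> \<open>The power of a maximum is one of the two powers, and both are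
      nonnegative.\<close>
    show "norm (2 ^ k * \<delta> k ^ ?N) \<le> 2 ^ k * \<psi> (2 ^ k) ^ ?N + 2 ^ k * \<eta> k ^ ?N" for k
      using pos[of k] by (auto simp: \<delta>_def max_def)
  qed
  \<comment> \<open>Terms of a convergent series tend to 0. As \<open>2 ^ k\<close> is at least 1,
    this gives the strict bound \<open>\<delta> k < 1\<close> required by the counting hypothesis,
    which can fail for small \<open>k\<close>.\<close>
  have "eventually (\<lambda>k. 2 ^ k * \<delta> k ^ ?N < 1) sequentially"
    using summable_LIMSEQ_zero[OF sum\<delta>] by (rule order_tendstoD) simp
  moreover have "eventually (\<lambda>k. M \<le> 2 ^ k) sequentially"
    using filterlim_realpow_sequentially_gt1[of "2::real"]
    by (auto simp: filterlim_at_infinity_conv_norm_at_top norm_power filterlim_at_top)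
  ultimately have "eventually (\<lambda>k. norm (\<Sum>q=2^k..2*2^k. measure \<mu> (rational_nbhd (\<delta> k) q \<gamma>))
      \<le> C2 * (2 ^ k * \<delta> k ^ ?N)) sequentially"
  proof eventually_elim
    case (elim k)
    have "\<delta> k ^ ?N \<le> 2 ^ k * \<delta> k ^ ?N"
      using pos[of k] mult_right_mono[of 1 "2 ^ k" "\<delta> k ^ ?N"] by (simp add: \<delta>_def)
    then have "\<delta> k ^ ?N < 1" using elim by linarith
    then have "\<delta> k < 1"
      using one_le_power[of "\<delta> k" ?N] by linarith
    then show ?case
      using bound[of "2 ^ k" "\<delta> k"] elim by (simp add: \<delta>_def \<eta>_def sum_nonneg mult.assoc)
  qed
  \<comment> \<open>The counting bound is available only for large \<open>k\<close>, hence the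
    eventual form of the comparison test.\<close>
  then have "summable (\<lambda>k. \<Sum>q=2^k..2*2^k. measure \<mu> (rational_nbhd (\<delta> k) q \<gamma>))"
    by (rule summable_comparison_test_ev) (intro summable_mult sum\<delta>)
  then show "well_approximable \<psi> \<gamma> \<in> null_sets \<mu>"
    using assms(2) anti
    by (intro well_approximable_null) (auto simp: borel_prob_on_cube_def \<delta>_def prob_space_def)
qed

end
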